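(* Let the set-valued operator $A:\mathbb{R}^n\rightrightarrows\mathbb{R}^n$ be partly smooth at $\bar x$ relative to a manifold $\mathcal{M}\subset\mathbb{R}^n$ and $r$-resolvent-regular at $\bar x$ for $\bar u\in\operatorname{ri}(A_\varepsilon(\bar x))$, where $A_\varepsilon$ is the $\varepsilon$-localization of $A$ around $(\bar x,\bar u)$. Let $\gamma\in\,]0,1/r[$, let $\varepsilon>0$ be sufficiently small, and put $$\mathcal{U}_{\varepsilon,\gamma}=\bigcup_{x\in\mathcal{M}\cap B_\varepsilon(\bar x)}\bigl(x+\gamma A_\varepsilon(x)\bigr),\qquad d=\operatorname{dist}\bigl(\bar x+\gamma\bar u,\ \operatorname{bdy}(\mathcal{U}_{\varepsilon,\gamma})\bigr).$$ Let $(x^{(k)},u^{(k)})_{k\in\mathbb{N}}$ be a sequence with $u^{(k)}\in A_\varepsilon(x^{(k)})$, $x^{(k)}\to\bar x$ and $u^{(k)}\to\bar u$. Let $K>0$ be such that $$\|(x^{(k)}+\gamma u^{(k)})-(\bar x+\gamma\bar u)\|\le d\quad\text{for all }k\ge K.$$ Then $x^{(k)}\in\mathcal{M}$ for all $k\ge K$. In particular, suppose there is $p>0$ such that $\|u^{(k)}-\bar u\|\le p\,\|x^{(k)}-\bar x\|$ for every $k\in\mathbb{N}$. Then: (i) If $L=\sum_{i=0}^{\infty}\|x^{(i)}-x^{(i+1)}\|<+\infty$, then $x^{(k)}\in\mathcal{M}$ for all $k\ge K$ with $$K=\min\Bigl\{k\ge0\ :\ \sum_{i=0}^{k-1}\|x^{(i)}-x^{(i+1)}\|\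 \ge\ L-\frac{d}{1+\gamma p}\Bigr\}.$$ (ii) If $\|x^{(k)}-\bar x\|\le C\rho^k$ for all $k$, for some $C>0$ and $\rho\in\,]0,1[$, then $x^{(k)}\in\mathcal{M}$ for all $k\ge K$ with $$K=\left\lceil\frac{\log d-\log(1+\gamma p)-\log C}{\log\rho}\right\rceil.$$
   Context: Notation. $B_\varepsilon(\bar x)=\{x:\|x-\bar x\|<\varepsilon\}$; $\operatorname{ri}$ is relative interior, $\operatorname{bdy}$ is boundary; $\operatorname{dist}(z,S)=\inf_{s\in S}\|z-s\|$; $\lceil\cdot\rceil$ is the ceiling. For a convex set $S$, $\operatorname{Lin}(S)=\operatorname{Aff}(S)-x$ ($x\in S$) is the linear subspace parallel to the affine hull of $S$. $T_{\mathcal{M}}(x)$, $N_{\mathcal{M}}(x)$ are the tangent and normal spaces of the manifold $\mathcal{M}$ at $x\in\mathcal{M}$; $P_V$ is the orthogonal projection onto $V$. Semicontinuity. $A$ is lower semi-continuous at $\bar x$ if for every $\bar u\in A(\bar x)$ and every sequence $x^{(k)}\in\operatorname{dom}A$ with $x^{(k)}\to\bar x$ there are $u^{(k)}\in A(x^{(k)})$ with $u^{(k)}\to\bar u$. $A$ is upper semi-continuous at $\bar x$ if $x^{(k)}\to\bar x$, $u^{(k)}\in A(x^{(k)})$, $u^{(k)}\to\bar u$ imply $\bar u\in A(\bar x)$. $A$ is upper semi-continuous if it is so at every point of its domain. Continuous along $\mathcal{M}$ means both lower and upper semi-continuous with sequences restricted to $\mathcal{M}$. Partly smooth operator. $A$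 is partly smooth at $\bar x$ relative to a set $\mathcal{M}\ni\bar x$ if $\mathcal{M}$ is a $C^q$-manifold ($q\ge1$) around $\bar x$, $A$ is upper semi-continuous, and: (Regularity) for every $x$ close to $\bar x$, $A(x)$ is nonempty, closed and convex; (Sharpness) $N_{\mathcal{M}}(\bar x)=\operatorname{Lin}(A(\bar x))$, and $x\mapsto P_{T_{\mathcal{M}}(x)}(A(x))$ is single-valued and continuous around $\bar x$ along $\mathcal{M}$; (Continuity) $A$ is continuous along $\mathcal{M}$ near $\bar x$. Localization. For $\varepsilon>0$ the $\varepsilon$-localization of $A$ around $(\bar x,\bar u)\in\operatorname{gra}(A)$ is $A_\varepsilon(x)=\{u\in A(x):\|u-\bar u\|<\varepsilon\}$ if $\|x-\bar x\|<\varepsilon$, and $A_\varepsilon(x)=\emptyset$ otherwise. Resolvent-regularity. $A$ is ($r$-)resolvent-regular at $\bar x$ for $\bar u\in A(\bar x)$ if there are $\varepsilon>0$ and $r>0$ such that $r\,\mathrm{Id}+A_\varepsilon$ is monotone and, for each $\gamma\in\,]0,1/r[$, there is a neighbourhood of $\bar x+\gamma\bar u$ on which the resolvent $J_{\gamma A_\varepsilon}=(\mathrm{Id}+\gamma A_\varepsilon)^{-1}$ is single-valued and continuous. *)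

theory Defs
  imports "HOL-Analysis.Analysis"
begin

section \<open>Manifolds in Euclidean space\<close>

text \<open>
  Continuous differentiability of order k on an open set, stated through iterated directional
  derivatives so that the type of the function does not change along the recursion.
  In finite dimension this is the usual class of k times continuously differentiable functions.
\<close>

primrec Ck_on :: "nat \<Rightarrow> ('a::real_normed_vector \<Rightarrow> 'b::real_normed_vector) \<Rightarrow> 'a set \<Rightarrow> bool" where
  "Ck_on 0 f S \<longleftrightarrow> continuous_on S f"
| "Ck_on (Suc k) f S \<longleftrightarrow>
     (\<forall>x\<in>S. f differentiable (at x)) \<and>
     (\<forall>v. Ck_on k (\<lambda>x. frechet_derivative f (at x) v) S)"

text \<open>
  M is, near x, the zero set of a submersion F of class q. The codomain of F is a
  subspace W of the ambient space; it stands for the Euclidean space of dimension dim W, the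
  codimension of M (which is at most the ambient dimension).
\<close>

definition Cq_manifold_around :: "nat \<Rightarrow> 'a::euclidean_space set \<Rightarrow> 'a \<Rightarrow> bool" where
  "Cq_manifold_around q M x \<longleftrightarrow> x \<in> M \<and>
     (\<exists>U W (F :: 'a \<Rightarrow> 'a). open U \<and> x \<in> U \<and> subspace W \<and> Ck_on q F U \<and> F ` U \<subseteq> W \<and>
        (\<forall>y\<in>U. range (frechet_derivative F (at y)) = W) \<and>
        M \<inter> U = {y \<in> U. F y = 0})"

definition tangent_space :: "'a::euclidean_space set \<Rightarrow> 'a \<Rightarrow> 'a set" where
  "tangent_space M x = {v. \<exists>(c :: real \<Rightarrow> 'a) \<delta>. \<delta> > 0 \<and> Ck_on 1 c {-\<delta><..<\<delta>} \<and>
     c ` {-\<delta><..<\<delta>} \<subseteq> M \<and> c 0 = x \<and> (c has_vector_derivative v) (at 0)}"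

definition normal_space :: "'a::euclidean_space set \<Rightarrow> 'a \<Rightarrow> 'a set" where
  "normal_space M x = orthogonal_comp (tangent_space M x)"

text \<open>
  The subspace parallel to the affine hull of S. The difference set of the affine hull with
  a single base point of S does not depend on that point, so the union over all of them is taken.
\<close>

definition Lin :: "'a::real_vector set \<Rightarrow> 'a set" where
  "Lin S = {y - x | x y. x \<in> S \<and> y \<in> affine hull S}"


section \<open>Set-valued operators\<close>

definition op_dom :: "('a \<Rightarrow> 'b set) \<Rightarrow> 'a set" where
  "op_dom A = {x. A x \<noteq> {}}"

text \<open>Semicontinuity at x with sequences restricted to S; S = UNIV gives the unrestricted notions.\<close>

definition lsc_at_within ::
    "('a::topological_space \<Rightarrow> 'b::topological_space set) \<Rightarrow> 'a \<Rightarrow> 'a set \<Rightarrow> bool" where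
  "lsc_at_within A x S \<longleftrightarrow>
     (\<forall>u\<in>A x. \<forall>X. (\<forall>k. X k \<in> op_dom A \<inter> S) \<and> X \<longlonglongrightarrow> x \<longrightarrow>
        (\<exists>V. (\<forall>k::nat. V k \<in> A (X k)) \<and> V \<longlonglongrightarrow> u))"

definition usc_at_within ::
    "('a::topological_space \<Rightarrow> 'b::topological_space set) \<Rightarrow> 'a \<Rightarrow> 'a set \<Rightarrow> bool" where
  "usc_at_within A x S \<longleftrightarrow>
     (\<forall>X V u. (\<forall>k::nat. X k \<in> S \<and> V k \<in> A (X k)) \<and> X \<longlonglongrightarrow> x \<and> V \<longlonglongrightarrow> u \<longrightarrow> u \<in> A x)"

definition usc :: "('a::topological_space \<Rightarrow> 'b::topological_space set) \<Rightarrow> bool" where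
  "usc A \<longleftrightarrow> (\<forall>x\<in>op_dom A. usc_at_within A x UNIV)"

text \<open>
  \<^const>\<open>closest_point\<close> of a subspace is the orthogonal projection onto it.
\<close>

definition partly_smooth ::
    "nat \<Rightarrow> ('a::euclidean_space \<Rightarrow> 'a set) \<Rightarrow> 'a \<Rightarrow> 'a set \<Rightarrow> bool" where
  "partly_smooth q A xbar M \<longleftrightarrow>
     q \<ge> 1 \<and> Cq_manifold_around q M xbar \<and> usc A \<and>
     (\<exists>\<delta>>0. \<forall>x\<in>ball xbar \<delta>. A x \<noteq> {} \<and> closed (A x) \<and> convex (A x)) \<and>
     normal_space M xbar = Lin (A xbar) \<and>
     (\<exists>\<delta>>0. \<exists>f. continuous_on (M \<inter> ball xbar \<delta>) f \<and>
        (\<forall>x\<in>M \<inter> ball xbar \<delta>. closest_point (tangent_space M x) ` A x = {f x})) \<and>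
     (\<exists>\<delta>>0. \<forall>x\<in>M \<inter> ball xbar \<delta>. lsc_at_within A x M \<and> usc_at_within A x M)"

definition localization ::
    "('a::real_normed_vector \<Rightarrow> 'b::real_normed_vector set) \<Rightarrow> 'a \<Rightarrow> 'b \<Rightarrow> real \<Rightarrow> 'a \<Rightarrow> 'b set" where
  "localization A xbar ubar \<epsilon> x =
     (if norm (x - xbar) < \<epsilon> then {u \<in> A x. norm (u - ubar) < \<epsilon>} else {})"

definition monotone_operator :: "('a::real_inner \<Rightarrow> 'a set) \<Rightarrow> bool" where
  "monotone_operator A \<longleftrightarrow>
     (\<forall>x y. \<forall>u\<in>A x. \<forall>v\<in>A y. (u - v) \<bullet> (x - y) \<ge> 0)"

definition resolvent :: "real \<Rightarrow> ('a::real_vector \<Rightarrow> 'a set) \<Rightarrow> 'a \<Rightarrow> 'a set" where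
  "resolvent \<gamma> A z = {x. z \<in> (\<lambda>u. x + \<gamma> *\<^sub>R u) ` A x}"

definition resolvent_regular ::
    "real \<Rightarrow> ('a::euclidean_space \<Rightarrow> 'a set) \<Rightarrow> 'a \<Rightarrow> 'a \<Rightarrow> bool" where
  "resolvent_regular r A xbar ubar \<longleftrightarrow>
     r > 0 \<and> ubar \<in> A xbar \<and>
     (\<exists>\<epsilon>>0. monotone_operator (\<lambda>x. (\<lambda>u. r *\<^sub>R x + u) ` localization A xbar ubar \<epsilon> x) \<and>
        (\<forall>\<gamma>. 0 < \<gamma> \<and> \<gamma> < 1 / r \<longrightarrow>
          (\<exists>V J. open V \<and> xbar + \<gamma> *\<^sub>R ubar \<in> V \<and> continuous_on V J \<and>
             (\<forall>z\<in>V. resolvent \<gamma> (localization A xbar ubar \<epsilon>) z = {J z}))))"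

end

theory Submission
  imports Defs
begin

text \<open>
  The point \<open>zbar = xbar + \<gamma> ubar\<close> is interior to \<open>U\<close>: the resolvent sends points near
  \<open>zbar\<close> to pairs \<open>(x, u)\<close> of the graph near \<open>(xbar, ubar)\<close>, and partial smoothness together
  with monotonicity of \<open>r Id + A\<close> forces such \<open>x\<close> to lie on \<open>M\<close>. Hence \<open>d > 0\<close>, and the closed ball
  of radius \<open>d\<close> about \<open>zbar\<close> is contained in the closure of \<open>U\<close>. If \<open>x + \<gamma> u\<close> is in this closure,
  it is a limit of points \<open>y + \<gamma> v\<close> with \<open>y \<in> M\<close>; the resolvent being Lipschitz, the \<open>y\<close>
  converge to \<open>x\<close>, and \<open>M\<close> is locally closed. The rates (i) and (ii) follow by bounding
  \<open>norm (x k - xbar)\<close> by \<open>d / (1 + \<gamma> p)\<close>.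
\<close>

section \<open>Strict differentiability of continuously differentiable maps\<close>

lemma Ck_on_imp_continuous_on:
  assumes "Ck_on k f S"
  shows "continuous_on S f"
  using assms by (cases k)
    (auto intro: continuous_at_imp_continuous_on differentiable_imp_continuous_within)

text \<open>Continuity of the derivative in each basis direction makes it close in operator norm to
  the derivative at \<open>x\<close> throughout a small ball. The mean value inequality for
  \<open>f\<close> minus its linear part at \<open>x\<close> then gives the bound. Uniformity in
  both \<open>y\<close> and \<open>z\<close> is what makes the Newton map used for the manifold a
  contraction.\<close>

lemma C1_strictly_differentiable:
  fixes f :: "'a::euclidean_space \<Rightarrow> 'b::real_normed_vector"
  assumes f: "Ck_on (Suc k) f S" and S: "open S" "x \<in> S" and e: "e > 0"
  obtains \<rho> where "\<rho> > 0" "cball x \<rho> \<subseteq> S"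
    "\<And>y z. y \<in> cball x \<rho> \<Longrightarrow> z \<in> cball x \<rho> \<Longrightarrow>
       norm (f y - f z - frechet_derivative f (at x) (y - z)) \<le> e * norm (y - z)"
proof -
  let ?D = "\<lambda>y. frechet_derivative f (at y)"
  have D: "(f has_derivative ?D y) (at y)" if "y \<in> S" for y
    using f that by (simp add: frechet_derivative_works[THEN iffD1])
  \<comment> \<open>An error \<open>e'\<close> in each basis direction adds up, over the
    \<open>DIM('a)\<close> coordinates of \<open>v\<close>, to at most
    \<open>e * norm v\<close>.\<close>
  define e' where "e' = e / real DIM('a)"
  have e': "e' > 0" using e by (simp add: e'_def)
  have "eventually (\<lambda>y. \<forall>b\<in>Basis. dist (?D y b) (?D x b) < e') (nhds x)"
  proof (intro eventually_ball_finite ballI)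
    fix b :: 'a
    have "continuous_on S (\<lambda>y. ?D y b)"
      using f Ck_on_imp_continuous_on by (metis Ck_on.simps(2))
    then have "((\<lambda>y. ?D y b) \<longlongrightarrow> ?D x b) (nhds x)"
      using S by (metis continuous_on_eq_continuous_at isCont_def tendsto_at_iff_tendsto_nhds)
    then show "eventually (\<lambda>y. dist (?D y b) (?D x b) < e') (nhds x)"
      using e' tendstoD by blast
  qed simp
  moreover have "eventually (\<lambda>y. y \<in> S) (nhds x)"
    using S eventually_nhds by blast
  ultimately have "eventually (\<lambda>y. y \<in> S \<and> (\<forall>b\<in>Basis. dist (?D y b) (?D x b) < e')) (nhds x)"
    by eventually_elim auto
  then obtain \<rho>' where \<rho>': "\<rho>' > 0"
    "\<And>y. dist y x < \<rho>' \<Longrightarrow> y \<in> S \<and> (\<forall>b\<in>Basis. dist (?D y b) (?D x b) < e')"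
    unfolding eventually_nhds_metric by blast
  define \<rho> where "\<rho> = \<rho>' / 2"
  have \<rho>: "\<rho> > 0" "cball x \<rho> \<subseteq> S"
    using \<rho>' by (auto simp: \<rho>_def dist_commute subset_iff)
  have lin: "linear (?D y)" if "y \<in> S" for y
    using D[OF that] has_derivative_linear by blast
  have on: "onorm (\<lambda>v. ?D y v - ?D x v) \<le> e" if y: "y \<in> cball x \<rho>" for y
  proof (rule onorm_bound)
    fix v :: 'a
    have yS: "y \<in> S" using y \<rho> by blast
    have b: "norm (?D y b - ?D x b) \<le> e'" if "b \<in> Basis" for b
    proof -
      have "dist y x < \<rho>'" using y \<rho>'(1) by (simp add: \<rho>_def dist_commute)
      then show ?thesis using \<rho>'(2) that by (simp add: dist_norm less_imp_le)
    qed
    have l: "linear (\<lambda>v. ?D y v - ?D x v)"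
      using lin[OF yS] lin[OF S(2)] by (rule linear_compose_sub)
    have "?D y v - ?D x v = (\<Sum>b\<in>Basis. (v \<bullet> b) *\<^sub>R (?D y b - ?D x b))"
      using linear_sum[OF l, of "\<lambda>b. (v \<bullet> b) *\<^sub>R b" Basis] linear_scale[OF l]
      by (simp add: euclidean_representation)
    also have "norm \<dots> \<le> (\<Sum>b\<in>(Basis :: 'a set). norm v * e')"
      by (intro order_trans[OF norm_sum] sum_mono) (auto intro!: mult_mono b Basis_le_norm)
    also have "\<dots> = e * norm v" by (simp add: e'_def)
    finally show "norm (?D y v - ?D x v) \<le> e * norm v" .
  qed (use e in simp)
  show thesis
  proof (rule that[OF \<rho>])
    fix y z assume yz: "y \<in> cball x \<rho>" "z \<in> cball x \<rho>"
    let ?g = "\<lambda>y. f y - ?D x y"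
    have "norm (?g y - ?g z) \<le> e * norm (y - z)"
    proof (rule differentiable_bound[of "cball x \<rho>"])
      fix w assume w: "w \<in> cball x \<rho>"
      have "(?D x has_derivative ?D x) (at w)"
        using D[OF S(2)] by (simp add: bounded_linear_imp_has_derivative has_derivative_bounded_linear)
      then show "(?g has_derivative (\<lambda>v. ?D w v - ?D x v)) (at w within cball x \<rho>)"
        using D[of w] w \<rho> by (blast intro: has_derivative_diff has_derivative_at_withinI)
    qed (use on yz in auto)
    then show "norm (f y - f z - ?D x (y - z)) \<le> e * norm (y - z)"
      unfolding linear_diff[OF lin[OF S(2)]] by (simp add: algebra_simps)
  qed
qed

section \<open>First-order geometry of the manifold\<close>

text \<open>The defining map \<open>F\<close> vanishes along a curve in \<open>M\<close> as long as
  the curve stays in \<open>U\<close>, so the chain rule at time 0 annihilates the velocity.\<close>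

lemma tangent_space_subset_kernel:
  assumes U: "open U" "x \<in> U" and MU: "M \<inter> U = {y \<in> U. F y = 0}"
    and F: "(F has_derivative E) (at x)" and v: "v \<in> tangent_space M x"
  shows "E v = 0"
proof -
  from v obtain c \<delta> where c: "\<delta> > 0" "c ` {-\<delta><..<\<delta>} \<subseteq> M" "c 0 = x"
    "(c has_vector_derivative v) (at 0)"
    unfolding tangent_space_def by blast
  have "((\<lambda>t. F (c t)) has_derivative (\<lambda>t. E (t *\<^sub>R v))) (at 0)"
    using has_derivative_compose[of c "\<lambda>t. t *\<^sub>R v" 0 UNIV F E] c F
    by (simp add: has_vector_derivative_def)
  moreover have "((\<lambda>t. F (c t)) has_derivative (\<lambda>t. 0)) (at 0)"
  proof (rule has_derivative_transform_eventually[of "\<lambda>t. 0"])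
    have "isCont c 0" using c(4) has_vector_derivative_continuous by blast
    then have "eventually (\<lambda>t. c t \<in> U) (at 0)"
      using U c(3) by (metis isCont_def topological_tendstoD)
    moreover have "eventually (\<lambda>t::real. t \<in> {-\<delta><..<\<delta>}) (at 0)"
      using c(1) by (intro eventually_at_in_open') auto
    ultimately show "\<forall>\<^sub>F t in at 0. 0 = F (c t)"
      by eventually_elim (use c(2) MU in force)
    show "0 = F (c 0)" using c MU U by force
  qed auto
  ultimately have "(\<lambda>t::real. E (t *\<^sub>R v)) = (\<lambda>t. 0)"
    using has_derivative_unique by blast
  then show ?thesis by (metis scaleR_one)
qed

lemma manifold_locally_closed:
  assumes "Cq_manifold_around q M x"
  obtains U where "open U" "x \<in> U" "closedin (top_of_set U) (M \<inter> U)"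
proof -
  from assms obtain U and F :: "'a \<Rightarrow> 'a" where "open U" "x \<in> U" "Ck_on q F U"
    "M \<inter> U = {y \<in> U. F y = 0}"
    unfolding Cq_manifold_around_def by blast
  then show thesis
    using that continuous_closedin_preimage_constant Ck_on_imp_continuous_on by metis
qed

text \<open>For \<open>v\<close> in the kernel of \<open>E\<close>, the point \<open>y + t v\<close>
  almost solves \<open>F z = 0\<close>; correcting it through a right inverse \<open>L\<close> of
  \<open>E\<close> reaches \<open>M\<close> with an error that is small relative to
  \<open>t v\<close>. The vector \<open>v\<close> is tangent at \<open>x\<close>, while the base
  point \<open>y\<close> may be any nearby point of \<open>M\<close>, with the same radius for all
  \<open>y\<close>, \<open>v\<close> and \<open>t\<close>. This uniformity is needed when base
  points converge to \<open>x\<close>.\<close>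

lemma manifold_tangent_approximation:
  assumes M: "Cq_manifold_around q M x" and q: "q \<ge> 1" and \<eta>: "\<eta> > 0"
  obtains \<rho> where "\<rho> > 0"
    "\<And>y v t. y \<in> M \<inter> ball x \<rho> \<Longrightarrow> v \<in> tangent_space M x \<Longrightarrow> norm (t *\<^sub>R v) < \<rho> \<Longrightarrow>
       \<exists>z\<in>M. norm (z - y - t *\<^sub>R v) \<le> \<eta> * norm (t *\<^sub>R v)"
proof -
  obtain k where k: "q = Suc k" using q by (cases q) auto
  from M obtain U W and F :: "'a \<Rightarrow> 'a" where U: "open U" "x \<in> U" and F: "Ck_on q F U" "F ` U \<subseteq> W"
    and W: "\<forall>y\<in>U. range (frechet_derivative F (at y)) = W" and MU: "M \<inter> U = {y \<in> U. F y = 0}"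
    unfolding Cq_manifold_around_def by blast
  define E where "E = frechet_derivative F (at x)"
  have E: "(F has_derivative E) (at x)"
    using F U unfolding E_def k by (simp add: frechet_derivative_works[THEN iffD1])
  have lE: "linear E" using E has_derivative_linear by blast
  obtain L where L: "linear L" "\<And>w. w \<in> W \<Longrightarrow> E (L w) = w"
    using linear_exists_right_inverse_on[OF lE subspace_UNIV] W U unfolding E_def by blast
  obtain B where B: "B > 0" "\<And>v. norm (L v) \<le> B * norm v"
    using linear_bounded_pos[OF L(1)] by blast
  \<comment> \<open>\<open>\<mu>\<close> is the contraction constant of the iteration:
    \<open>\<mu> \<le> 1/2\<close> makes it preserve the ball of radius \<open>2 * norm a\<close>
    around \<open>y\<close>, and \<open>2 * \<mu> \<le> \<eta>\<close> bounds the final error.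
    Strict differentiability is invoked with \<open>\<mu> / B\<close> to absorb the norm of
    \<open>L\<close>.\<close>
  define \<mu> where "\<mu> = min \<eta> 1 / 2"
  have \<mu>: "\<mu> > 0" "\<mu> \<le> 1/2" "2 * \<mu> \<le> \<eta>" using \<eta> by (auto simp: \<mu>_def)
  obtain \<rho> where \<rho>: "\<rho> > 0" "cball x \<rho> \<subseteq> U"
    "\<And>y z. y \<in> cball x \<rho> \<Longrightarrow> z \<in> cball x \<rho> \<Longrightarrow> norm (F y - F z - E (y - z)) \<le> \<mu> / B * norm (y - z)"
    using C1_strictly_differentiable[OF F(1)[unfolded k] U, of "\<mu> / B"] B(1) \<mu>(1)
    unfolding E_def by (metis divide_pos_pos)
  show thesis
  \<comment> \<open>One third of the radius is spent on \<open>y\<close>, the other two on the ball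
    of radius \<open>2 * norm a\<close> in which the iteration runs.\<close>
  proof (rule that[of "\<rho> / 3"])
    show "\<rho> / 3 > 0" using \<rho> by simp
    fix y v t assume y: "y \<in> M \<inter> ball x (\<rho> / 3)" and v: "v \<in> tangent_space M x"
      and t: "norm (t *\<^sub>R v) < \<rho> / 3"
    define a where "a = t *\<^sub>R v"
    have Ea: "E a = 0"
      unfolding a_def using tangent_space_subset_kernel[OF U MU E v] lE by (simp add: linear_scale)
    have sub: "cball y (2 * norm a) \<subseteq> cball x \<rho>"
      using t y unfolding a_def[symmetric] by (auto simp: cball_subset_cball_iff dist_commute)
    have yU: "y \<in> U" using sub \<rho>(2) by (meson centre_in_cball mult_nonneg_nonneg norm_ge_zero subset_iff zero_le_numeral)
    have Fy: "F y = 0" using y yU MU by blast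
    text \<open>A simplified Newton iteration for \<open>F z = 0\<close>; its fixed points satisfy
      \<open>F z = E (z - T z) = 0\<close> because \<open>E \<circ> L\<close> is the identity on the values of \<open>F\<close> and \<open>E\<close>.\<close>
    define T where "T z = y + a + L (E (z - y) - F z)" for z
    have contr: "norm (T z - T z') \<le> \<mu> * norm (z - z')"
      if "z \<in> cball y (2 * norm a)" "z' \<in> cball y (2 * norm a)" for z z'
    proof -
      have "T z - T z' = L (E (z - z') - (F z - F z'))"
        unfolding T_def using L(1) lE by (simp add: linear_diff linear_add algebra_simps)
      also have "norm \<dots> \<le> B * norm (F z - F z' - E (z - z'))"
        using B(2) by (metis norm_minus_commute)
      also have "\<dots> \<le> B * (\<mu> / B * norm (z - z'))"
        using B(1) that sub by (intro mult_left_mono \<rho>(3)) auto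
      finally show ?thesis using B(1) by simp
    qed
    have Ty: "T y = y + a" unfolding T_def using L(1) lE Fy by (simp add: linear_0)
    have "\<exists>!z\<in>cball y (2 * norm a). T z = z"
    proof (rule Banach_fix)
      show "T ` cball y (2 * norm a) \<subseteq> cball y (2 * norm a)"
      proof clarify
        fix z assume z: "z \<in> cball y (2 * norm a)"
        have "norm (T z - T y) \<le> \<mu> * norm (z - y)" using contr[OF z] by simp
        also have "\<dots> \<le> (1/2) * (2 * norm a)"
          using \<mu> z by (intro mult_mono) (auto simp: dist_norm norm_minus_commute)
        finally have "norm (T z - y - a) \<le> norm a" unfolding Ty by (simp add: algebra_simps)
        then show "T z \<in> cball y (2 * norm a)"
          using norm_triangle_ineq[of "T z - y - a" a] by (simp add: dist_norm norm_minus_commute)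
      qed
      show "0 \<le> \<mu>" "\<mu> < 1" using \<mu> by auto
      show "dist (T z) (T z') \<le> \<mu> * dist z z'"
        if "z \<in> cball y (2 * norm a)" "z' \<in> cball y (2 * norm a)" for z z'
        using contr[OF that] by (simp add: dist_norm)
    qed (auto intro: closed_cball complete_eq_closed[THEN iffD2])
    then obtain z where z: "z \<in> cball y (2 * norm a)" "T z = z" by blast
    have zU: "z \<in> U" using z(1) sub \<rho>(2) by blast
    have "norm (z - y - a) \<le> \<mu> * norm (z - y)"
      using contr[OF z(1), of y] z(2) Ty by (simp add: algebra_simps)
    also have "\<dots> \<le> \<mu> * (2 * norm a)"
      using z(1) \<mu> by (intro mult_left_mono) (auto simp: dist_norm norm_minus_commute)
    also have "\<dots> \<le> \<eta> * norm a" using mult_right_mono[OF \<mu>(3), of "norm a"] by simp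
    finally have *: "norm (z - y - a) \<le> \<eta> * norm a" .
    have "E (L (E (z - y))) = E (z - y)" "E (L (F z)) = F z"
      using L(2) W U F(2) zU unfolding E_def by blast+
    then have "E (T z) = E y + E a + (E (z - y) - F z)"
      unfolding T_def using L(1) lE by (simp add: linear_diff linear_add)
    then have "F z = 0" using z(2) Ea lE by (simp add: linear_diff)
    then have "z \<in> M" using zU MU by blast
    then show "\<exists>z\<in>M. norm (z - y - t *\<^sub>R v) \<le> \<eta> * norm (t *\<^sub>R v)"
      using * unfolding a_def by blast
  qed
qed

text \<open>Since \<open>y k\<close> is nearest to \<open>p k\<close>, no \<open>z\<close> on the
  manifold near \<open>x\<close> lies closer; expanding the squares gives \<open>2 * ((p k - y k)
  \<bullet> (z - y k)) \<le> (norm (z - y k))\<^sup>2\<close>. Choosing \<open>z\<close> close to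
  \<open>y k + s t v\<close> with \<open>v\<close> tangent at the limit point \<open>x\<close> and
  \<open>s\<close> a sign, and dividing by the step length, leaves a bound of order \<eta>. Letting
  first \<open>t\<close> tend to 0, then \<open>k\<close> to infinity, then \<eta> to 0, with both
  signs, gives orthogonality to \<open>v\<close>.\<close>

lemma limit_of_proximal_normals:
  fixes p y :: "nat \<Rightarrow> 'a::euclidean_space"
  assumes M: "Cq_manifold_around q M x" and q: "q \<ge> 1" and e: "e > 0"
    and y: "\<And>k. y k \<in> M" "y \<longlonglongrightarrow> x"
    and closest: "\<And>k z. z \<in> M \<inter> ball x e \<Longrightarrow> dist (p k) (y k) \<le> dist (p k) z"
    and ne: "\<And>k. p k \<noteq> y k"
    and w: "(\<lambda>k. (p k - y k) /\<^sub>R norm (p k - y k)) \<longlonglongrightarrow> w"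
  shows "w \<in> normal_space M x"
proof -
  define W where "W k = (p k - y k) /\<^sub>R norm (p k - y k)" for k
  have half: "s * (w \<bullet> v) \<le> \<eta> * norm v"
    if v: "v \<in> tangent_space M x" and s: "\<bar>s\<bar> = 1" and \<eta>: "0 < \<eta>" "\<eta> < 1" for v and s \<eta> :: real
  proof -
    obtain \<rho> where \<rho>: "\<rho> > 0"
      "\<And>y t. y \<in> M \<inter> ball x \<rho> \<Longrightarrow> norm (t *\<^sub>R v) < \<rho> \<Longrightarrow>
         \<exists>z\<in>M. norm (z - y - t *\<^sub>R v) \<le> \<eta> * norm (t *\<^sub>R v)"
      using manifold_tangent_approximation[OF M q \<eta>(1)] v by metis
    have "s * (W k \<bullet> v) \<le> \<eta> * norm v" if k: "dist (y k) x < min \<rho> (e/2)" for k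
    proof -
      define h where "h = norm (p k - y k)"
      have h: "h > 0" "p k - y k = h *\<^sub>R W k" using ne[of k] by (auto simp: h_def W_def)
      \<comment> \<open>Here \<open>k\<close>, hence \<open>h\<close>, is fixed while
        \<open>t\<close> tends to 0. The quadratic term therefore vanishes even though nothing
        bounds \<open>h\<close> away from 0 as \<open>k\<close> grows.\<close>
      have "eventually (\<lambda>t. s * (W k \<bullet> v) \<le> 2 * t * (norm v)\<^sup>2 / h + \<eta> * norm v) (at_right 0)"
      proof -
        have "((\<lambda>t. t * norm v) \<longlongrightarrow> 0 * norm v) (at_right (0::real))"
          by (intro tendsto_intros)
        \<comment> \<open>The bound \<open>e/4\<close> keeps \<open>z\<close>, which is within
          \<open>2 * (t * norm v)\<close> of \<open>y k\<close>, inside the ball where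
          \<open>y k\<close> is known to be nearest.\<close>
        then have "eventually (\<lambda>t. t * norm v < min \<rho> (e/4)) (at_right 0)"
          using \<rho>(1) e by (intro order_tendstoD) auto
        moreover have "eventually (\<lambda>t::real. t > 0) (at_right 0)"
          by (rule eventually_at_right_less)
        ultimately show ?thesis
        proof eventually_elim
          case (elim t)
          have st: "norm ((s * t) *\<^sub>R v) = t * norm v" using s elim by (simp add: abs_mult)
          obtain z where z: "z \<in> M" "norm (z - y k - (s * t) *\<^sub>R v) \<le> \<eta> * (t * norm v)"
            using \<rho>(2)[of "y k" "s * t"] k y(1) elim st by (auto simp: dist_commute)
          have "norm (z - y k) \<le> norm (z - y k - (s * t) *\<^sub>R v) + norm ((s * t) *\<^sub>R v)"
            using norm_triangle_ineq[of "z - y k - (s * t) *\<^sub>R v" "(s * t) *\<^sub>R v"] by simp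
          also have "\<dots> \<le> t * norm v + t * norm v"
            using z(2) \<eta> elim(2) mult_right_mono[of \<eta> 1 "t * norm v"] unfolding st
            by (smt (verit) mult_nonneg_nonneg norm_ge_zero)
          finally have zy: "norm (z - y k) \<le> 2 * (t * norm v)" by simp
          then have "dist z x < e" using k elim(1) dist_triangle[of z x "y k"] by (simp add: dist_norm)
          then have "norm (p k - y k) \<le> norm (p k - z)"
            using closest[of z k] z(1) by (simp add: dist_norm dist_commute norm_minus_commute)
          then have "(norm (p k - y k))\<^sup>2 \<le> (norm ((p k - y k) - (z - y k)))\<^sup>2"
            by (simp add: power_mono)
          also have "\<dots> = (norm (p k - y k))\<^sup>2 - 2 * ((p k - y k) \<bullet> (z - y k)) + (norm (z - y k))\<^sup>2"
            unfolding power2_norm_eq_inner by (simp add: inner_diff inner_commute)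
          finally have "2 * ((p k - y k) \<bullet> (z - y k)) \<le> (norm (z - y k))\<^sup>2" by simp
          also have "\<dots> \<le> (2 * (t * norm v))\<^sup>2" using zy by (intro power_mono) auto
          finally have 1: "h * (W k \<bullet> (z - y k)) \<le> 2 * t\<^sup>2 * (norm v)\<^sup>2"
            unfolding h(2) by (simp add: power_mult_distrib)
          have "W k \<bullet> ((s * t) *\<^sub>R v - (z - y k)) \<le> norm (W k) * norm ((s * t) *\<^sub>R v - (z - y k))"
            by (rule norm_cauchy_schwarz)
          also have "\<dots> \<le> 1 * (\<eta> * (t * norm v))"
            using z(2) by (intro mult_mono) (auto simp: W_def norm_minus_commute divide_simps)
          finally have 2: "t * (s * (W k \<bullet> v)) \<le> W k \<bullet> (z - y k) + \<eta> * (t * norm v)"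
            by (simp add: inner_diff_right algebra_simps)
          have 3: "W k \<bullet> (z - y k) \<le> 2 * t\<^sup>2 * (norm v)\<^sup>2 / h" using 1 h(1) by (simp add: field_simps)
          have "t * (s * (W k \<bullet> v)) \<le> t * (2 * t * (norm v)\<^sup>2 / h + \<eta> * norm v)"
            using 2 3 by (simp add: algebra_simps power2_eq_square)
          then show ?case using elim(2) by simp
        qed
      qed
      moreover have "((\<lambda>t. 2 * t * (norm v)\<^sup>2 / h + \<eta> * norm v) \<longlongrightarrow> 2 * 0 * (norm v)\<^sup>2 / h + \<eta> * norm v)
          (at_right (0::real))"
        using h(1) by (intro tendsto_intros) auto
      ultimately show ?thesis by (intro tendsto_lowerbound) auto
    qed
    moreover have "eventually (\<lambda>k. dist (y k) x < min \<rho> (e/2)) sequentially"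
      using y(2) \<rho>(1) e by (intro tendstoD) auto
    ultimately have "eventually (\<lambda>k. s * (W k \<bullet> v) \<le> \<eta> * norm v) sequentially"
      by (simp add: eventually_mono)
    moreover have "(\<lambda>k. s * (W k \<bullet> v)) \<longlonglongrightarrow> s * (w \<bullet> v)"
      using w unfolding W_def by (intro tendsto_intros)
    ultimately show ?thesis by (intro tendsto_upperbound) auto
  qed
  have "s * (w \<bullet> v) \<le> 0" if "v \<in> tangent_space M x" "\<bar>s\<bar> = 1" for v s
  proof -
    have "eventually (\<lambda>\<eta>. s * (w \<bullet> v) \<le> \<eta> * norm v) (at_right 0)"
      using half[OF that] eventually_at_right_real[of 0 1] by (auto elim!: eventually_mono)
    moreover have "((\<lambda>\<eta>. \<eta> * norm v) \<longlongrightarrow> 0 * norm v) (at_right (0::real))"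
      by (intro tendsto_intros)
    ultimately show ?thesis using tendsto_lowerbound by fastforce
  qed
  from this[of _ 1] this[of _ "-1"] have "w \<bullet> v = 0" if "v \<in> tangent_space M x" for v
    using that by force
  then show ?thesis
    unfolding normal_space_def orthogonal_comp_def by (auto simp: orthogonal_def inner_commute)
qed

section \<open>Identification of the manifold from nearby points of the graph\<close>

text \<open>Cutting a convex set with an open ball around one of its points preserves the affine
  hull. A relative interior point of the localization can thus be moved slightly in every direction
  parallel to the affine hull of the whole of \<open>A xbar\<close>.\<close>

lemma rel_interior_localization_shift:
  assumes conv: "convex (A xbar)" and ri: "ubar \<in> rel_interior (localization A xbar ubar \<epsilon> xbar)"
    and w: "w \<in> Lin (A xbar)" and e: "e > 0"
  obtains t where "0 < t" "t < e" "ubar + t *\<^sub>R w \<in> A xbar"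
proof -
  let ?S = "localization A xbar ubar \<epsilon> xbar"
  from ri obtain \<delta> where \<delta>: "\<delta> > 0" "ball ubar \<delta> \<inter> affine hull ?S \<subseteq> ?S" and ub: "ubar \<in> ?S"
    unfolding mem_rel_interior_ball by blast
  have eps: "\<epsilon> > 0" using ub by (auto simp: localization_def split: if_splits)
  have S: "?S = A xbar \<inter> ball ubar \<epsilon>"
    using eps by (auto simp: localization_def dist_norm norm_minus_commute)
  have aff: "affine hull ?S = affine hull A xbar"
    unfolding S using conv ub S by (intro affine_hull_convex_Int_open) auto
  from w obtain a b where ab: "w = b - a" "a \<in> A xbar" "b \<in> affine hull A xbar"
    unfolding Lin_def by blast
  have "((\<lambda>t. t * norm w) \<longlongrightarrow> 0 * norm w) (at_right (0::real))"
    by (intro tendsto_intros)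
  then have "eventually (\<lambda>t. t * norm w < \<delta>) (at_right 0)"
    using \<delta>(1) by (intro order_tendstoD) auto
  moreover have "eventually (\<lambda>t::real. t \<in> {0<..<e}) (at_right 0)"
    using e by (rule eventually_at_right_real)
  ultimately have "eventually (\<lambda>t. t * norm w < \<delta> \<and> t \<in> {0<..<e}) (at_right 0)"
    by eventually_elim auto
  then obtain t where t: "t * norm w < \<delta>" "0 < t" "t < e"
    using eventually_happens'[OF trivial_limit_at_right_real] by force
  have "ubar + t *\<^sub>R (b - a) \<in> affine hull A xbar"
    using ub S ab by (intro mem_affine_3_minus affine_affine_hull) (auto intro: hull_inc)
  then have "ubar + t *\<^sub>R w \<in> ?S"
    using \<delta>(2) t aff ab(1) by (auto simp: dist_norm)
  then show thesis using that t S by blast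
qed

text \<open>A sequence violating the claim would have nearest points \<open>Y n\<close> on the manifold, and
  the normalized differences \<open>X n - Y n\<close> would accumulate at a unit normal \<open>w\<close>. By sharpness
  and the relative interior condition \<open>ubar + t w\<close> lies in \<open>A xbar\<close>, so by continuity along
  the manifold it is approximated by points of \<open>A (Y n)\<close>; in the limit the monotonicity
  inequality reads \<open>- t \<ge> 0\<close>.\<close>

lemma partly_smooth_identification:
  fixes A :: "'a::euclidean_space \<Rightarrow> 'a set"
  assumes ps: "partly_smooth q A xbar M"
    and ri: "ubar \<in> rel_interior (localization A xbar ubar \<epsilon> xbar)"
    and mono: "monotone_operator (\<lambda>x. (\<lambda>u. r *\<^sub>R x + u) ` localization A xbar ubar \<epsilon>\<^sub>0 x)"
    and \<epsilon>\<^sub>0: "\<epsilon>\<^sub>0 > 0"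
  obtains \<eta> where "\<eta> > 0"
    "\<And>x u. norm (x - xbar) < \<eta> \<Longrightarrow> norm (u - ubar) < \<eta> \<Longrightarrow> u \<in> A x \<Longrightarrow> x \<in> M"
proof -
  from ps have M: "Cq_manifold_around q M xbar" and q: "q \<ge> 1"
    and NL: "normal_space M xbar = Lin (A xbar)"
    unfolding partly_smooth_def by auto
  have xM: "xbar \<in> M" using M unfolding Cq_manifold_around_def by blast
  obtain U where U: "open U" "xbar \<in> U" "closedin (top_of_set U) (M \<inter> U)"
    using manifold_locally_closed[OF M] by blast
  obtain \<delta>1 where \<delta>1: "\<delta>1 > 0" "\<And>x. x \<in> ball xbar \<delta>1 \<Longrightarrow> A x \<noteq> {} \<and> convex (A x)"
    using ps unfolding partly_smooth_def by meson
  have lsc: "lsc_at_within A xbar M"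
    using ps xM unfolding partly_smooth_def by (metis Int_iff centre_in_ball)
  obtain \<delta>2 where \<delta>2: "\<delta>2 > 0" "cball xbar \<delta>2 \<subseteq> U" using U open_contains_cball by metis
  \<comment> \<open>Radius \<open>\<delta>2\<close> makes the piece of \<open>M\<close> closed, so
    nearest points exist; staying below \<open>\<delta>1\<close> keeps \<open>A\<close> nonempty at
    them, and staying below \<open>\<epsilon>\<^sub>0\<close> keeps all points where monotonicity
    applies.\<close>
  define e where "e = min \<delta>2 (min (\<delta>1/2) (\<epsilon>\<^sub>0/2))"
  have e: "e > 0" "e \<le> \<delta>2" "e < \<delta>1" "e < \<epsilon>\<^sub>0" using \<delta>1 \<delta>2 \<epsilon>\<^sub>0 by (auto simp: e_def)
  obtain T where T: "closed T" "M \<inter> U = U \<inter> T" using U(3) by (auto simp: closedin_closed)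
  have "M \<inter> cball xbar e = T \<inter> cball xbar e"
    using T(2) \<delta>2(2) subset_cball[OF e(2), of xbar] by blast
  then have cl: "closed (M \<inter> cball xbar e)" using T(1) by (simp add: closed_Int)
  show thesis
  proof (rule ccontr)
    assume contra: "\<not> thesis"
    have "\<exists>x u. norm (x - xbar) < e / (2 * real (Suc n)) \<and> norm (u - ubar) < e / (2 * real (Suc n)) \<and>
        u \<in> A x \<and> x \<notin> M" for n
      using that[of "e / (2 * real (Suc n))"] contra e(1) by (meson divide_pos_pos mult_pos_pos of_nat_0_less_iff zero_less_Suc zero_less_numeral)
    then obtain X V where XV: "\<And>n. norm (X n - xbar) < e / (2 * real (Suc n))"
      "\<And>n. norm (V n - ubar) < e / (2 * real (Suc n))" "\<And>n. V n \<in> A (X n)" "\<And>n. X n \<notin> M"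
      by metis
    have lim0: "(\<lambda>n. e / (2 * real (Suc n))) \<longlonglongrightarrow> 0" by real_asymp
    have small: "e / (2 * real (Suc n)) \<le> e / 2" for n
      using e(1) by (simp add: field_simps)
    have X: "X \<longlonglongrightarrow> xbar" and V: "V \<longlonglongrightarrow> ubar"
      using XV(1,2) by (auto intro!: LIM_zero_cancel Lim_null_comparison[OF _ lim0] eventuallyI less_imp_le)
    have "\<exists>y\<in>M \<inter> cball xbar e. \<forall>z\<in>M \<inter> cball xbar e. dist (X n) y \<le> dist (X n) z" for n
      using distance_attains_inf[OF cl] xM e(1) by (metis IntI centre_in_cball empty_iff less_imp_le)
    then obtain Y where Y: "\<And>n. Y n \<in> M \<inter> cball xbar e"
      "\<And>n z. z \<in> M \<inter> cball xbar e \<Longrightarrow> dist (X n) (Y n) \<le> dist (X n) z"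
      by metis
    \<comment> \<open>The point \<open>xbar\<close> itself competes for being nearest, which forces
      \<open>Y\<close> to converge to \<open>xbar\<close> as well.\<close>
    have XY: "norm (X n - Y n) \<le> norm (X n - xbar)" for n
      using Y(2)[of xbar n] xM e(1) by (simp add: dist_norm)
    have XY0: "(\<lambda>n. X n - Y n) \<longlonglongrightarrow> 0"
      by (rule Lim_null_comparison[OF _ lim0], intro eventuallyI) (use XY XV(1) in \<open>meson less_imp_le order_trans\<close>)
    have Ylim: "Y \<longlonglongrightarrow> xbar" using tendsto_diff[OF X XY0] by simp
    have ne: "X n \<noteq> Y n" for n using XV(4) Y(1) by (metis IntD1)
    define w where "w n = (X n - Y n) /\<^sub>R norm (X n - Y n)" for n
    have "w n \<in> sphere 0 1" for n using ne by (simp add: w_def)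
    then obtain wb s where wb: "wb \<in> sphere 0 1" and s: "strict_mono s" and ws: "(w \<circ> s) \<longlonglongrightarrow> wb"
      using compact_sphere[of "0::'a" 1] unfolding compact_def by metis
    have Ys: "(Y \<circ> s) \<longlonglongrightarrow> xbar" and Vs: "(V \<circ> s) \<longlonglongrightarrow> ubar" and XYs: "(\<lambda>n. X (s n) - Y (s n)) \<longlonglongrightarrow> 0"
      using LIMSEQ_subseq_LIMSEQ[OF _ s] Ylim V XY0 by (auto simp: o_def)
    have "wb \<in> normal_space M xbar"
      using limit_of_proximal_normals[OF M q e(1), of "Y \<circ> s" "X \<circ> s" wb] Y ne Ys ws
      by (auto simp: w_def o_def)
    \<comment> \<open>As \<open>wb\<close> is a unit vector, \<open>t < \<epsilon>\<^sub>0\<close>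
      places the approximants \<open>Z n\<close> eventually in the localization where monotonicity
      is known.\<close>
    then obtain t where t: "0 < t" "t < \<epsilon>\<^sub>0" "ubar + t *\<^sub>R wb \<in> A xbar"
      using rel_interior_localization_shift[of A xbar, OF _ ri _ \<epsilon>\<^sub>0] NL \<delta>1 by auto
    have "Y (s n) \<in> op_dom A \<inter> M" for n
      using Y(1)[of "s n"] \<delta>1(2)[of "Y (s n)"] e(3) by (auto simp: op_dom_def)
    then obtain Z where Z: "\<And>n. Z n \<in> A (Y (s n))" "Z \<longlonglongrightarrow> ubar + t *\<^sub>R wb"
      using lsc t(3) Ys unfolding lsc_at_within_def by (metis comp_apply)
    have Zsmall: "eventually (\<lambda>n. norm (Z n - ubar) < \<epsilon>\<^sub>0) sequentially"
    proof -
      have "(\<lambda>n. norm (Z n - ubar)) \<longlonglongrightarrow> norm (ubar + t *\<^sub>R wb - ubar)"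
        by (intro tendsto_intros Z)
      then show ?thesis using t wb by (intro order_tendstoD) auto
    qed
    \<comment> \<open>The monotonicity inequality divided by
      \<open>norm (X (s n) - Y (s n))\<close>: the contribution of \<open>r Id\<close> keeps one
      factor of this norm and disappears in the limit.\<close>
    have "eventually (\<lambda>n. (V (s n) - Z n) \<bullet> w (s n) \<ge> - r * norm (X (s n) - Y (s n))) sequentially"
      using Zsmall
    proof eventually_elim
      case (elim n)
      define h where "h = norm (X (s n) - Y (s n))"
      have h: "h > 0" "X (s n) - Y (s n) = h *\<^sub>R w (s n)"
        using ne by (auto simp: h_def w_def)
      have 1: "V (s n) \<in> localization A xbar ubar \<epsilon>\<^sub>0 (X (s n))"
      proof -
        have "norm (X (s n) - xbar) < \<epsilon>\<^sub>0" "norm (V (s n) - ubar) < \<epsilon>\<^sub>0"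
          using XV(1,2)[of "s n"] small[of "s n"] e by linarith+
        then show ?thesis using XV(3) by (simp add: localization_def)
      qed
      have 2: "Z n \<in> localization A xbar ubar \<epsilon>\<^sub>0 (Y (s n))"
        using Z(1) elim Y(1)[of "s n"] e by (auto simp: localization_def dist_norm norm_minus_commute)
      have "0 \<le> ((r *\<^sub>R X (s n) + V (s n)) - (r *\<^sub>R Y (s n) + Z n)) \<bullet> (X (s n) - Y (s n))"
        using mono 1 2 unfolding monotone_operator_def by blast
      also have "\<dots> = (r *\<^sub>R (X (s n) - Y (s n)) + (V (s n) - Z n)) \<bullet> (X (s n) - Y (s n))"
        by (simp add: algebra_simps)
      also have "\<dots> = r * h\<^sup>2 + (V (s n) - Z n) \<bullet> (X (s n) - Y (s n))"
        by (simp add: inner_add_left h_def power2_norm_eq_inner)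
      also have "\<dots> = h * (r * h + (V (s n) - Z n) \<bullet> w (s n))"
        unfolding h(2) by (simp add: algebra_simps power2_eq_square)
      finally show ?case using h(1) by (simp add: zero_le_mult_iff h_def)
    qed
    moreover have "(\<lambda>n. (V (s n) - Z n) \<bullet> w (s n)) \<longlonglongrightarrow> (ubar - (ubar + t *\<^sub>R wb)) \<bullet> wb"
      using Vs Z(2) ws by (intro tendsto_intros) (auto simp: o_def)
    moreover have "(\<lambda>n. - r * norm (X (s n) - Y (s n))) \<longlonglongrightarrow> - r * norm (0::'a)"
      by (intro tendsto_intros XYs)
    ultimately have "- r * norm (0::'a) \<le> (ubar - (ubar + t *\<^sub>R wb)) \<bullet> wb"
      using tendsto_le[OF sequentially_bot] by blast
    moreover have "wb \<bullet> wb = 1" using wb by (simp add: norm_eq_1)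
    ultimately show False using t(1) by simp
  qed
qed

section \<open>The resolvent and the set \<open>U\<close>\<close>

text \<open>The operator \<open>Id + \<gamma> B\<close> is strongly monotone with modulus
  \<open>1 - \<gamma> * r\<close>; Cauchy-Schwarz turns this into a distance estimate. For
  \<open>\<gamma> * r < 1\<close> it is the Lipschitz bound for the resolvent.\<close>

lemma resolvent_monotone_dist:
  assumes mono: "monotone_operator (\<lambda>x. (\<lambda>u. r *\<^sub>R x + u) ` B x)" and \<gamma>: "\<gamma> > 0"
    and u: "u \<in> B x" and v: "v \<in> B y"
  shows "(1 - \<gamma> * r) * norm (x - y) \<le> norm ((x + \<gamma> *\<^sub>R u) - (y + \<gamma> *\<^sub>R v))"
proof (cases "x = y")
  case False
  have "0 \<le> ((r *\<^sub>R x + u) - (r *\<^sub>R y + v)) \<bullet> (x - y)"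
    using mono u v unfolding monotone_operator_def by blast
  then have "0 \<le> \<gamma> * (((r *\<^sub>R x + u) - (r *\<^sub>R y + v)) \<bullet> (x - y))" using \<gamma> by simp
  also have "\<dots> = ((x + \<gamma> *\<^sub>R u) - (y + \<gamma> *\<^sub>R v)) \<bullet> (x - y) - (1 - \<gamma> * r) * ((x - y) \<bullet> (x - y))"
    by (simp add: algebra_simps)
  also have "\<dots> \<le> norm ((x + \<gamma> *\<^sub>R u) - (y + \<gamma> *\<^sub>R v)) * norm (x - y) - (1 - \<gamma> * r) * (norm (x - y) * norm (x - y))"
    using norm_cauchy_schwarz[of "(x + \<gamma> *\<^sub>R u) - (y + \<gamma> *\<^sub>R v)" "x - y"]
    by (simp add: norm_eq_sqrt_inner)
  also have "\<dots> = (norm ((x + \<gamma> *\<^sub>R u) - (y + \<gamma> *\<^sub>R v)) - (1 - \<gamma> * r) * norm (x - y)) * norm (x - y)"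
    by (simp add: algebra_simps)
  finally show ?thesis using False by (simp add: zero_le_mult_iff)
qed simp

text \<open>The open ball is connected, meets \<open>S\<close> and misses its frontier, so it lies
  in \<open>S\<close>; taking closures admits points at distance exactly \<open>d\<close>. If the
  distance is 0, which includes the convention for an empty frontier, the ball is a single
  point.\<close>

lemma cball_infdist_frontier_subset_closure:
  fixes a :: "'a::euclidean_space"
  assumes "a \<in> interior S"
  shows "cball a (infdist a (frontier S)) \<subseteq> closure S"
proof (cases "infdist a (frontier S) > 0")
  case True
  have "ball a (infdist a (frontier S)) \<inter> frontier S = {}"
    by (auto simp: infdist_le leD)
  moreover have "a \<in> ball a (infdist a (frontier S)) \<inter> S"
    using True assms interior_subset by auto
  ultimately have "ball a (infdist a (frontier S)) \<subseteq> S"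
    using connected_Int_frontier[OF connected_ball, of a "infdist a (frontier S)" S] by blast
  then show ?thesis using closure_ball[OF True] closure_mono by metis
next
  case False
  then have "infdist a (frontier S) = 0" using infdist_nonneg[of a "frontier S"] by simp
  then show ?thesis using assms interior_subset closure_subset by auto
qed

lemma resolvent_base_point_interior:
  fixes A :: "'a::real_normed_vector \<Rightarrow> 'a set"
  assumes J: "open V" "xbar + \<gamma> *\<^sub>R ubar \<in> V" "continuous_on V J"
      "\<And>z. z \<in> V \<Longrightarrow> resolvent \<gamma> (localization A xbar ubar \<epsilon>\<^sub>0) z = {J z}"
    and ubar: "ubar \<in> A xbar" and pos: "\<epsilon>\<^sub>0 > 0" "\<gamma> > 0" "\<epsilon> > 0" "\<eta> > 0"
    and ident: "\<And>x u. norm (x - xbar) < \<eta> \<Longrightarrow> norm (u - ubar) < \<eta> \<Longrightarrow> u \<in> A x \<Longrightarrow> x \<in> M"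
  shows "xbar + \<gamma> *\<^sub>R ubar \<in>
    interior (\<Union>x\<in>M \<inter> ball xbar \<epsilon>. (\<lambda>u. x + \<gamma> *\<^sub>R u) ` localization A xbar ubar \<epsilon> x)"
    (is "?z \<in> interior ?U")
proof -
  have "xbar \<in> resolvent \<gamma> (localization A xbar ubar \<epsilon>\<^sub>0) ?z"
    using ubar pos by (auto simp: resolvent_def localization_def)
  then have Jz: "J ?z = xbar" using J(4)[OF J(2)] by simp
  have J1: "(J \<longlongrightarrow> xbar) (nhds ?z)"
    using J(1-3) Jz by (metis continuous_on_eq_continuous_at isCont_def tendsto_at_iff_tendsto_nhds)
  \<comment> \<open>This quotient is the operator value paired with \<open>J z\<close> in the
    decomposition of \<open>z\<close>, so it inherits continuity from \<open>J\<close>.\<close>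
  have "((\<lambda>z. (z - J z) /\<^sub>R \<gamma>) \<longlongrightarrow> (?z - xbar) /\<^sub>R \<gamma>) (nhds ?z)"
    by (intro tendsto_intros J1) (simp add: filterlim_ident)
  then have J2: "((\<lambda>z. (z - J z) /\<^sub>R \<gamma>) \<longlongrightarrow> ubar) (nhds ?z)" using pos by simp
  \<comment> \<open>Closeness \<eta> puts \<open>J z\<close> on \<open>M\<close>; closeness
    \<epsilon> moves the pair from the larger localization into the one defining
    \<open>U\<close>.\<close>
  have m: "min \<eta> \<epsilon> > 0" using pos by simp
  have "eventually (\<lambda>z. z \<in> ?U) (nhds ?z)"
    using tendstoD[OF J1 m] tendstoD[OF J2 m] eventually_nhds_in_open[OF J(1,2)]
  proof eventually_elim
    case (elim z)
    define u where "u = (z - J z) /\<^sub>R \<gamma>"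
    have "J z \<in> resolvent \<gamma> (localization A xbar ubar \<epsilon>\<^sub>0) z" using J(4) elim by simp
    then obtain u' where u': "u' \<in> localization A xbar ubar \<epsilon>\<^sub>0 (J z)" "z = J z + \<gamma> *\<^sub>R u'"
      by (auto simp: resolvent_def)
    have "z - J z = \<gamma> *\<^sub>R u'" using u'(2) by (metis add_diff_cancel_left')
    then have "u' = u" unfolding u_def using pos by simp
    then have u: "u \<in> A (J z)" "z = J z + \<gamma> *\<^sub>R u"
      using u' by (auto simp: localization_def split: if_splits)
    have b: "norm (J z - xbar) < min \<eta> \<epsilon>" "norm (u - ubar) < min \<eta> \<epsilon>"
      using elim by (simp_all add: dist_norm u_def)
    have "J z \<in> M" using ident[of "J z" u] b u by simp
    then have "J z \<in> M \<inter> ball xbar \<epsilon>" "u \<in> localization A xbar ubar \<epsilon> (J z)"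
      using b u by (auto simp: localization_def dist_norm norm_minus_commute)
    then show ?case using u(2) by blast
  qed
  then show ?thesis by (auto simp: eventually_nhds interior_def)
qed

text \<open>Only the first components of the approximating points are controlled: by the distance
  estimate they converge to \<open>x\<close>, and \<open>x\<close> lies in \<open>S\<close>,
  relative to which \<open>M\<close> is closed.\<close>

lemma manifold_member_of_closure:
  fixes A :: "'a::euclidean_space \<Rightarrow> 'a set"
  assumes mono: "monotone_operator (\<lambda>x. (\<lambda>u. r *\<^sub>R x + u) ` localization A xbar ubar \<epsilon> x)"
    and \<gamma>: "\<gamma> > 0" "\<gamma> * r < 1"
    and cl: "closedin (top_of_set S) (M \<inter> S)" and S: "ball xbar \<epsilon> \<subseteq> S"
    and u: "u \<in> localization A xbar ubar \<epsilon> x"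
    and z: "x + \<gamma> *\<^sub>R u \<in>
      closure (\<Union>x\<in>M \<inter> ball xbar \<epsilon>. (\<lambda>u. x + \<gamma> *\<^sub>R u) ` localization A xbar ubar \<epsilon> x)"
  shows "x \<in> M"
proof -
  from z obtain Z where Z: "Z \<longlonglongrightarrow> x + \<gamma> *\<^sub>R u"
    "\<And>n. Z n \<in> (\<Union>x\<in>M \<inter> ball xbar \<epsilon>. (\<lambda>u. x + \<gamma> *\<^sub>R u) ` localization A xbar ubar \<epsilon> x)"
    unfolding closure_sequential by blast
  then have "\<exists>y v. y \<in> M \<inter> ball xbar \<epsilon> \<and> v \<in> localization A xbar ubar \<epsilon> y \<and> Z n = y + \<gamma> *\<^sub>R v" for n
    by blast
  then obtain Y W where Y: "\<And>n. Y n \<in> M \<inter> ball xbar \<epsilon>"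
    and W: "\<And>n. W n \<in> localization A xbar ubar \<epsilon> (Y n)" "\<And>n. Z n = Y n + \<gamma> *\<^sub>R W n"
    by metis
  have lim: "(\<lambda>n. norm (Z n - (x + \<gamma> *\<^sub>R u)) / (1 - \<gamma> * r)) \<longlonglongrightarrow> 0"
    using tendsto_divide[OF tendsto_norm_zero[OF LIM_zero[OF Z(1)]] tendsto_const[of "1 - \<gamma> * r"]] \<gamma>
    by simp
  have "norm (Y n - x) \<le> norm (Z n - (x + \<gamma> *\<^sub>R u)) / (1 - \<gamma> * r)" for n
    using resolvent_monotone_dist[OF mono \<gamma>(1) W(1) u, of n] \<gamma>(2) W(2)
    by (simp add: pos_le_divide_eq mult.commute)
  then have Yx: "Y \<longlonglongrightarrow> x"
    by (auto intro!: LIM_zero_cancel Lim_null_comparison[OF _ lim] eventuallyI)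
  have xS: "x \<in> S" using u S
    by (auto simp: localization_def dist_norm norm_minus_commute split: if_splits)
  obtain T where T: "closed T" "M \<inter> S = S \<inter> T" using cl by (auto simp: closedin_closed)
  have "Y n \<in> T" for n using Y[of n] S T(2) by blast
  then have "x \<in> T" using closed_sequentially[OF T(1) _ Yx] by blast
  then show ?thesis using xS T(2) by blast
qed

section \<open>Two bounds for the speed of convergence\<close>

text \<open>Telescoping bounds the distance from \<open>x k\<close> to \<open>x n\<close> by a
  segment of the series; then \<open>n\<close> tends to infinity.\<close>

lemma norm_diff_limit_le_suminf_tail:
  fixes x :: "nat \<Rightarrow> 'a::real_normed_vector"
  assumes x: "x \<longlonglongrightarrow> l" and sm: "summable (\<lambda>i. norm (x i - x (i + 1)))"
  shows "norm (x k - l) \<le> (\<Sum>i. norm (x i - x (i + 1))) - (\<Sum>i<k. norm (x i - x (i + 1)))"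
proof (rule tendsto_upperbound)
  show "(\<lambda>n. norm (x k - x n)) \<longlonglongrightarrow> norm (x k - l)"
    by (intro tendsto_intros x)
  show "eventually (\<lambda>n. norm (x k - x n) \<le>
      (\<Sum>i. norm (x i - x (i + 1))) - (\<Sum>i<k. norm (x i - x (i + 1)))) sequentially"
    using eventually_ge_at_top[of k]
  proof eventually_elim
    case (elim n)
    have "x k - x n = (\<Sum>i=k..<n. x i - x (i + 1))"
      using sum_Suc_diff'[OF elim, of x] by (simp add: sum_subtractf algebra_simps)
    also have "norm \<dots> \<le> (\<Sum>i=k..<n. norm (x i - x (i + 1)))" by (rule norm_sum)
    also have "\<dots> = (\<Sum>i<n. norm (x i - x (i + 1))) - (\<Sum>i<k. norm (x i - x (i + 1)))"
      using sum_diff_nat_ivl[of 0 k n "\<lambda>i. norm (x i - x (i + 1))"] elim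
      by (simp add: lessThan_atLeast0)
    also have "\<dots> \<le> (\<Sum>i. norm (x i - x (i + 1))) - (\<Sum>i<k. norm (x i - x (i + 1)))"
      using sum_le_suminf[OF sm, of "{..<n}"] by simp
    finally show ?case .
  qed
qed simp

text \<open>Take logarithms; multiplying by the negative \<open>ln \<rho>\<close> reverses the
  inequality.\<close>

lemma geometric_le_after_log_ratio:
  fixes C \<rho> d b :: real
  assumes "C > 0" "0 < \<rho>" "\<rho> < 1" "d > 0" "b > 0"
    and k: "int k \<ge> \<lceil>(ln d - ln b - ln C) / ln \<rho>\<rceil>"
  shows "C * \<rho> ^ k \<le> d / b"
proof -
  have "ln \<rho> < 0" using assms by simp
  moreover have "(ln d - ln b - ln C) / ln \<rho> \<le> real k" using k by linarith
  ultimately have "real k * ln \<rho> \<le> ln d - ln b - ln C" by (simp add: neg_divide_le_eq)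
  then have "ln (C * \<rho> ^ k) \<le> ln (d / b)"
    using assms by (simp add: ln_mult ln_div ln_realpow)
  then show ?thesis using assms by simp
qed

section \<open>Finite identification and the two explicit iteration counts\<close>

theorem proposition7:
  fixes A :: "real ^ 'n \<Rightarrow> (real ^ 'n) set"
    and M :: "(real ^ 'n) set"
    and xbar ubar :: "real ^ 'n"
    and r \<gamma> :: real
    and q :: nat
  assumes "partly_smooth q A xbar M"
    and "resolvent_regular r A xbar ubar"
    and "0 < \<gamma>" and "\<gamma> < 1 / r"
  shows "\<forall>\<^sub>F \<epsilon> in at_right 0.
    ubar \<in> rel_interior (localization A xbar ubar \<epsilon> xbar) \<longrightarrow>
    (let A\<epsilon> = localization A xbar ubar \<epsilon>;
         U = (\<Union>x\<in>M \<inter> ball xbar \<epsilon>. (\<lambda>u. x + \<gamma> *\<^sub>R u) ` A\<epsilon> x);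
         d = infdist (xbar + \<gamma> *\<^sub>R ubar) (frontier U)
     in \<forall>x u :: nat \<Rightarrow> real ^ 'n.
          (\<forall>k. u k \<in> A\<epsilon> (x k)) \<and> x \<longlonglongrightarrow> xbar \<and> u \<longlonglongrightarrow> ubar \<longrightarrow>
          (\<forall>K>0. (\<forall>k\<ge>K. norm ((x k + \<gamma> *\<^sub>R u k) - (xbar + \<gamma> *\<^sub>R ubar)) \<le> d) \<longrightarrow>
             (\<forall>k\<ge>K. x k \<in> M)) \<and>
          (\<forall>p>0. (\<forall>k. norm (u k - ubar) \<le> p * norm (x k - xbar)) \<longrightarrow>
             (summable (\<lambda>i. norm (x i - x (i + 1))) \<longrightarrow>
                (let L = (\<Sum>i. norm (x i - x (i + 1)));
                     S = {k. (\<Sum>i<k. norm (x i - x (i + 1))) \<ge> L - d / (1 + \<gamma> * p)}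
                 in S \<noteq> {} \<and> (\<forall>k\<ge>(LEAST k. k \<in> S). x k \<in> M))) \<and>
             (\<forall>C>0. \<forall>\<rho>. 0 < \<rho> \<and> \<rho> < 1 \<and> (\<forall>k. norm (x k - xbar) \<le> C * \<rho> ^ k) \<longrightarrow>
                (\<forall>k. int k \<ge> \<lceil>(ln d - ln (1 + \<gamma> * p) - ln C) / ln \<rho>\<rceil> \<longrightarrow> x k \<in> M))))"
proof -
  note ps = assms(1) and \<gamma> = assms(3,4)
  from assms(2) have r: "r > 0" and ubar: "ubar \<in> A xbar"
    by (simp_all add: resolvent_regular_def)
  from assms(2) obtain \<epsilon>\<^sub>0 where \<epsilon>\<^sub>0: "\<epsilon>\<^sub>0 > 0"
    and mono: "monotone_operator (\<lambda>x. (\<lambda>u. r *\<^sub>R x + u) ` localization A xbar ubar \<epsilon>\<^sub>0 x)"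
    and res: "\<forall>\<gamma>. 0 < \<gamma> \<and> \<gamma> < 1 / r \<longrightarrow>
      (\<exists>V J. open V \<and> xbar + \<gamma> *\<^sub>R ubar \<in> V \<and> continuous_on V J \<and>
        (\<forall>z\<in>V. resolvent \<gamma> (localization A xbar ubar \<epsilon>\<^sub>0) z = {J z}))"
    unfolding resolvent_regular_def by (elim conjE exE)
  obtain V J where J: "open V" "xbar + \<gamma> *\<^sub>R ubar \<in> V" "continuous_on V J"
      "\<And>z. z \<in> V \<Longrightarrow> resolvent \<gamma> (localization A xbar ubar \<epsilon>\<^sub>0) z = {J z}"
    using res[rule_format, OF conjI[OF \<gamma>]] by metis
  have \<gamma>r: "\<gamma> * r < 1" using \<gamma> r by (simp add: field_simps)
  have "Cq_manifold_around q M xbar" using ps unfolding partly_smooth_def by blast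
  then obtain S where S: "open S" "xbar \<in> S" "closedin (top_of_set S) (M \<inter> S)"
    using manifold_locally_closed by blast
  obtain \<delta> where \<delta>: "\<delta> > 0" "ball xbar \<delta> \<subseteq> S" using S open_contains_ball by metis
  \<comment> \<open>Below \<open>\<epsilon>\<^sub>0\<close> monotonicity passes to the smaller
    localization; below \<open>\<delta>\<close> the ball stays where \<open>M\<close> is relatively
    closed.\<close>
  have "eventually (\<lambda>\<epsilon>. \<epsilon> \<in> {0<..<min \<epsilon>\<^sub>0 \<delta>}) (at_right 0)"
    using \<epsilon>\<^sub>0 \<delta>(1) by (intro eventually_at_right_real) simp
  then show ?thesis
  proof (rule eventually_mono, intro impI, goal_cases)
    case (1 \<epsilon>)
    then have \<epsilon>: "\<epsilon> > 0" "\<epsilon> < \<epsilon>\<^sub>0" "\<epsilon> < \<delta>"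
      and ri: "ubar \<in> rel_interior (localization A xbar ubar \<epsilon> xbar)" by auto
    have "localization A xbar ubar \<epsilon> x \<subseteq> localization A xbar ubar \<epsilon>\<^sub>0 x" for x
      using \<epsilon> by (auto simp: localization_def)
    then have mono': "monotone_operator (\<lambda>x. (\<lambda>u. r *\<^sub>R x + u) ` localization A xbar ubar \<epsilon> x)"
      using mono unfolding monotone_operator_def by blast
    obtain \<eta> where \<eta>: "\<eta> > 0"
      "\<And>x u. norm (x - xbar) < \<eta> \<Longrightarrow> norm (u - ubar) < \<eta> \<Longrightarrow> u \<in> A x \<Longrightarrow> x \<in> M"
      using partly_smooth_identification[OF ps ri mono \<epsilon>\<^sub>0] by blast
    define U where
      "U = (\<Union>x\<in>M \<inter> ball xbar \<epsilon>. (\<lambda>u. x + \<gamma> *\<^sub>R u) ` localization A xbar ubar \<epsilon> x)"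
    define d where "d = infdist (xbar + \<gamma> *\<^sub>R ubar) (frontier U)"
    have int: "xbar + \<gamma> *\<^sub>R ubar \<in> interior U"
      unfolding U_def
      by (rule resolvent_base_point_interior[OF J ubar \<epsilon>\<^sub>0 \<gamma>(1) \<epsilon>(1) \<eta>(1)]) (use \<eta>(2) in auto)
    \<comment> \<open>Boundedness makes the frontier nonempty, so that \<open>d\<close> is a genuine
      distance and, \<open>U\<close> containing the base point in its interior, positive. Otherwise
      \<open>infdist\<close> would be 0 by convention.\<close>
    have "U \<subseteq> cball 0 (norm xbar + \<epsilon> + \<gamma> * (norm ubar + \<epsilon>))"
    proof
      fix z assume "z \<in> U"
      then obtain x u where z: "z = x + \<gamma> *\<^sub>R u" and b: "norm (x - xbar) < \<epsilon>" "norm (u - ubar) < \<epsilon>"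
        by (auto simp: U_def localization_def split: if_splits)
      have "norm z \<le> norm x + \<gamma> * norm u"
        unfolding z using norm_triangle_ineq[of x "\<gamma> *\<^sub>R u"] \<gamma>(1) by simp
      also have "\<dots> \<le> (norm xbar + \<epsilon>) + \<gamma> * (norm ubar + \<epsilon>)"
        using b \<gamma>(1) norm_triangle_ineq2[of x xbar] norm_triangle_ineq2[of u ubar]
        by (intro add_mono mult_left_mono) auto
      finally show "z \<in> cball 0 (norm xbar + \<epsilon> + \<gamma> * (norm ubar + \<epsilon>))" by simp
    qed
    then have "bounded U" using bounded_cball bounded_subset by blast
    then have "frontier U \<noteq> {}" using int interior_subset frontier_not_empty not_bounded_UNIV by blast
    then have d: "d > 0"
      unfolding d_def using int by (intro infdist_pos_not_in_closed frontier_closed) (auto simp: frontier_def)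
    have key: "x \<in> M" if "u \<in> localization A xbar ubar \<epsilon> x"
      "norm ((x + \<gamma> *\<^sub>R u) - (xbar + \<gamma> *\<^sub>R ubar)) \<le> d" for x u
    proof (rule manifold_member_of_closure[OF mono' \<gamma>(1) \<gamma>r S(3) _ that(1)])
      show "ball xbar \<epsilon> \<subseteq> S" using \<delta>(2) \<epsilon>(3) by auto
      have "x + \<gamma> *\<^sub>R u \<in> cball (xbar + \<gamma> *\<^sub>R ubar) d"
        using that(2) by (simp add: dist_norm norm_minus_commute)
      then have "x + \<gamma> *\<^sub>R u \<in> closure U"
        using cball_infdist_frontier_subset_closure[OF int] unfolding d_def by blast
      then show "x + \<gamma> *\<^sub>R u \<in> closure (\<Union>x\<in>M \<inter> ball xbar \<epsilon>. (\<lambda>u. x + \<gamma> *\<^sub>R u) ` localization A xbar ubar \<epsilon> x)"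
        unfolding U_def .
    qed
    \<comment> \<open>The linear bound on \<open>u - ubar\<close> makes the displacement of
      \<open>x + \<gamma> u\<close> at most \<open>(1 + \<gamma> * p) * norm (x - xbar)\<close>,
      whence the threshold.\<close>
    have key': "x \<in> M" if "u \<in> localization A xbar ubar \<epsilon> x" "p > 0"
      "norm (u - ubar) \<le> p * norm (x - xbar)" "norm (x - xbar) \<le> d / (1 + \<gamma> * p)" for x u p
    proof (rule key[OF that(1)])
      have pos: "1 + \<gamma> * p > 0" using \<gamma>(1) that(2) by (simp add: add_pos_pos)
      have "norm ((x + \<gamma> *\<^sub>R u) - (xbar + \<gamma> *\<^sub>R ubar)) = norm ((x - xbar) + \<gamma> *\<^sub>R (u - ubar))"
        by (simp add: algebra_simps)
      also have "\<dots> \<le> norm (x - xbar) + \<gamma> * norm (u - ubar)"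
        using norm_triangle_ineq[of "x - xbar" "\<gamma> *\<^sub>R (u - ubar)"] \<gamma>(1) by simp
      also have "\<dots> \<le> norm (x - xbar) + \<gamma> * (p * norm (x - xbar))"
        using that(3) \<gamma>(1) by simp
      also have "\<dots> = norm (x - xbar) * (1 + \<gamma> * p)" by (simp add: algebra_simps)
      also have "\<dots> \<le> d" using that(4) pos by (simp add: pos_le_divide_eq)
      finally show "norm ((x + \<gamma> *\<^sub>R u) - (xbar + \<gamma> *\<^sub>R ubar)) \<le> d" .
    qed
    \<comment> \<open>Positivity of \<open>d\<close> puts the threshold strictly below the sum of
      the series, so partial sums pass it and the \<open>LEAST\<close> in (i) is attained.\<close>
    have S_nonempty: "\<exists>k. (\<Sum>i. norm (x i - x (i + 1))) - d / (1 + \<gamma> * p) \<le> (\<Sum>i<k. norm (x i - x (i + 1)))"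
      if p: "p > 0" and sm: "summable (\<lambda>i. norm (x i - x (i + 1)))" for x :: "nat \<Rightarrow> real ^ 'n" and p
    proof -
      have "0 < d / (1 + \<gamma> * p)" using d p \<gamma>(1) by (simp add: add_pos_pos)
      then have "eventually (\<lambda>k. (\<Sum>i<k. norm (x i - x (i + 1))) >
          (\<Sum>i. norm (x i - x (i + 1))) - d / (1 + \<gamma> * p)) sequentially"
        by (intro order_tendstoD(1)[OF summable_LIMSEQ[OF sm]]) simp
      then show ?thesis by (auto simp: eventually_sequentially intro: less_imp_le)
    qed
    show ?case
      unfolding Let_def U_def[symmetric] d_def[symmetric]
    proof (intro allI impI conjI; elim conjE)
      fix x u :: "nat \<Rightarrow> real ^ 'n" and K k :: nat
      assume "\<forall>k. u k \<in> localization A xbar ubar \<epsilon> (x k)" "k \<ge> K"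
        "\<forall>k\<ge>K. norm (x k + \<gamma> *\<^sub>R u k - (xbar + \<gamma> *\<^sub>R ubar)) \<le> d"
      then show "x k \<in> M" using key by blast
    next
      fix x u :: "nat \<Rightarrow> real ^ 'n" and p :: real
      assume p: "0 < p" and sm: "summable (\<lambda>i. norm (x i - x (i + 1)))"
      then show "{k. (\<Sum>i. norm (x i - x (i + 1))) - d / (1 + \<gamma> * p) \<le> (\<Sum>i<k. norm (x i - x (i + 1)))} \<noteq> {}"
        using S_nonempty[OF p sm] by blast
    next
      fix x u :: "nat \<Rightarrow> real ^ 'n" and p :: real and k :: nat
      let ?S = "{k. (\<Sum>i. norm (x i - x (i + 1))) - d / (1 + \<gamma> * p) \<le> (\<Sum>i<k. norm (x i - x (i + 1)))}"
      assume u: "\<forall>k. u k \<in> localization A xbar ubar \<epsilon> (x k)" and x: "x \<longlonglongrightarrow> xbar" and p: "0 < p"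
        and up: "\<forall>k. norm (u k - ubar) \<le> p * norm (x k - xbar)"
        and sm: "summable (\<lambda>i. norm (x i - x (i + 1)))" and k: "(LEAST k. k \<in> ?S) \<le> k"
      have "\<exists>k. k \<in> ?S" using S_nonempty[OF p sm] by blast
      then have "(LEAST k. k \<in> ?S) \<in> ?S" by (rule LeastI_ex)
      \<comment> \<open>Partial sums of nonnegative terms increase, so every index from the least
        one on meets the threshold.\<close>
      moreover have "(\<Sum>i<(LEAST k. k \<in> ?S). norm (x i - x (i + 1))) \<le> (\<Sum>i<k. norm (x i - x (i + 1)))"
        using k by (intro sum_mono2) auto
      ultimately have "norm (x k - xbar) \<le> d / (1 + \<gamma> * p)"
        using norm_diff_limit_le_suminf_tail[OF x sm, of k] by simp
      then show "x k \<in> M" using key' u up p by blast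
    next
      fix x u :: "nat \<Rightarrow> real ^ 'n" and p C \<rho> :: real and k :: nat
      assume u: "\<forall>k. u k \<in> localization A xbar ubar \<epsilon> (x k)" and p: "0 < p"
        and up: "\<forall>k. norm (u k - ubar) \<le> p * norm (x k - xbar)"
        and C: "C > 0" "0 < \<rho>" "\<rho> < 1" "\<forall>k. norm (x k - xbar) \<le> C * \<rho> ^ k"
        and k: "\<lceil>(ln d - ln (1 + \<gamma> * p) - ln C) / ln \<rho>\<rceil> \<le> int k"
      have "C * \<rho> ^ k \<le> d / (1 + \<gamma> * p)"
        using p \<gamma>(1) by (intro geometric_le_after_log_ratio C(1-3) d k) (simp add: add_pos_pos)
      then have "norm (x k - xbar) \<le> d / (1 + \<gamma> * p)" using C(4) order_trans by blast
      then show "x k \<in> M" using key' u up p by blast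
    qed
  qed
qed

end
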